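(* Let $p$ be either of the two mesh patterns $p_1=(12,\{(0,0),(0,1),(1,0),(1,1)\})$ and $p_2=(12,\{(0,1),(1,1),(1,2),(2,1)\})$, and let $T_{n,k}$ be the number of permutations in $S_n$ with exactly $k$ occurrences of $p$. Then $$T_{n,k} = T_{n-1,k-1}+ (n-1)T_{n-1,k}\qquad (n\ge 2,\ k\ge 1),$$ with the initial conditions $T_{n,0}=(n-1)!$ for $n\geq 1$ and $T_{0,0}=1$. Consequently, for $n\ge1$ and $k\ge 0$, $T_{n,k}=C(n,k+1)$, where $C(n,j)$ denotes the unsigned Stirling number of the first kind, and for $n\ge 1$ $$\sum_{k=0}^{n-1}T_{n,k}x^k=\prod_{i=1}^{n-1}(x+i).$$
   Context: $S_n$ is the set of permutations $\pi=\pi_1\cdots\pi_n$ of $\{1,\dots,n\}$ ($S_0$ contains only the empty permutation). A mesh pattern $(12,R)$ consists of the permutation $12$ and a set $R\subseteq\{0,1,2\}\times\{0,1,2\}$ of shaded boxes. An occurrence of $(12,R)$ in $\pi\in S_n$ is a pair of positions $s<t$ with $\pi_s<\pi_t$ such that, putting $s_0=0,\ s_1=s,\ s_2=t,\ s_3=n+1$ and $v_0=0,\ v_1=\pi_s,\ v_2=\pi_t,\ v_3=n+1$, for every $(i,j)\in R$ there is no position $m$ with $s_i<m<s_{i+1}$ and $v_j<\pi_m<v_{j+1}$. The unsigned Stirling number of the first kind $C(n,j)$ is the number of permutations in $S_n$ with exactly $j$ cycles. *)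

theory Defs
  imports "HOL-Combinatorics.Combinatorics" "HOL-Computational_Algebra.Polynomial"
begin

text \<open>
  An element of \<open>S\<^sub>n\<close> is a function \<open>\<pi>\<close> with \<open>\<pi> permutes {1..n}\<close>; its \<open>i\<close>-th letter is \<open>\<pi> i\<close>.
  A mesh pattern \<open>(12, R)\<close> is represented by its set \<open>R \<subseteq> {0,1,2} \<times> {0,1,2}\<close> of shaded boxes,
  the first coordinate being the horizontal one (positions), the second the vertical one (values).
\<close>

definition mesh12_occs :: "(nat \<times> nat) set \<Rightarrow> nat \<Rightarrow> (nat \<Rightarrow> nat) \<Rightarrow> (nat \<times> nat) set" where
  "mesh12_occs R n \<pi> =
    {(s, t). s \<in> {1..n} \<and> t \<in> {1..n} \<and> s < t \<and> \<pi> s < \<pi> t \<and>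
      (let S = [0, s, t, n + 1]; V = [0, \<pi> s, \<pi> t, n + 1]
       in \<forall>(i, j)\<in>R. \<not> (\<exists>m\<in>{1..n}. S ! i < m \<and> m < S ! (i + 1) \<and> V ! j < \<pi> m \<and> \<pi> m < V ! (j + 1)))}"

definition mesh12_count :: "(nat \<times> nat) set \<Rightarrow> nat \<Rightarrow> nat \<Rightarrow> nat" where
  "mesh12_count R n k = card {\<pi>. \<pi> permutes {1..n} \<and> card (mesh12_occs R n \<pi>) = k}"

definition p1 :: "(nat \<times> nat) set" where
  "p1 = {(0,0), (0,1), (1,0), (1,1)}"

definition p2 :: "(nat \<times> nat) set" where
  "p2 = {(0,1), (1,1), (1,2), (2,1)}"

text \<open>Fixed points count as cycles: \<open>orbit \<pi> i = {i}\<close> if \<open>\<pi> i = i\<close>.\<close>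

definition num_cycles :: "nat \<Rightarrow> (nat \<Rightarrow> nat) \<Rightarrow> nat" where
  "num_cycles n \<pi> = card (orbit \<pi> ` {1..n})"

text \<open>The library's \<open>stirling\<close> is introduced by its recurrence; this is the combinatorial definition.\<close>

definition stirling_cycles :: "nat \<Rightarrow> nat \<Rightarrow> nat" where
  "stirling_cycles n j = card {\<pi>. \<pi> permutes {1..n} \<and> num_cycles n \<pi> = j}"

end

theory Submission
  imports Defs
begin

text \<open>
  Both counts and the cycle count have the same distribution because each statistic behaves in the
  same way under building permutations of \<open>{1..n+1}\<close> from those of \<open>{1..n}\<close>: there are \<open>n + 1\<close> ways
  to extend a permutation, exactly one of them raises the statistic by one, and the other \<open>n\<close>
  preserve it. This alone gives the recurrence of the Stirling numbers of the first kind
  (\<open>card_statistic_insertion\<close>).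

  An occurrence of \<open>p1\<close> is a pair \<open>(s, t)\<close> such that \<open>s\<close> is the only position left of \<open>t\<close> carrying
  a smaller letter. The extension appends a last letter \<open>a\<close> and moves up the letters that are at
  least \<open>a\<close>. Occurrences depend only on the relative order of letters up to \<open>t\<close>, so the old
  ones survive; the new position is the right end of an occurrence exactly if a single letter lies
  below it, that is, if \<open>a = 2\<close> (\<open>mesh12_occs_p1_insert_last\<close>).

  An occurrence of \<open>p2\<close> is a pair of consecutive values \<open>v, v + 1\<close> in this order, with no
  larger letter between them; equivalently, \<open>v\<close> is followed
  directly by \<open>v + 1\<close> in the subword of letters \<open>\<ge> v\<close>.
  The extension moves all letters up by one and places a new letter \<open>1\<close> at position \<open>a\<close>.
  The new letter is too small to spoil an old occurrence, and it starts one exactly if it stands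
  immediately before the letter \<open>2\<close> (\<open>mesh12_occs_p2_insert_least\<close>).

  For cycles, the new point either becomes a fixed point, which adds a cycle, or is spliced into an
  existing cycle in front of one of the \<open>n\<close> old points (\<open>card_orbits_transpose_insert\<close>).

  The starting values differ by one, since the only permutation of \<open>{1}\<close> has no occurrence but one
  cycle; this is the shift from \<open>k\<close> to \<open>k + 1\<close>.
\<close>

section \<open>Counting by insertion\<close>

text \<open>
  Here \<open>h \<pi>\<close> is the one choice that raises the statistic. The fibre over \<open>m\<close> therefore splits into
  the pairs with \<open>a = h \<pi>\<close>, one for each \<open>\<pi>\<close> of value \<open>m - 1\<close>, and the pairs with \<open>a \<noteq> h \<pi>\<close>,
  \<open>card B - 1\<close> of them for each \<open>\<pi>\<close> of value \<open>m\<close>. Writing \<open>Suc (f \<pi>) = m\<close> covers \<open>m = 0\<close> as well,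
  where the first part is empty.
\<close>
lemma card_statistic_insertion:
  fixes f :: "'a \<Rightarrow> nat" and f' :: "'c \<Rightarrow> nat"
  assumes fin: "finite A" "finite B"
    and bij: "bij_betw g (A \<times> B) A'"
    and h: "\<And>\<pi>. \<pi> \<in> A \<Longrightarrow> h \<pi> \<in> B"
    and f': "\<And>\<pi> a. \<pi> \<in> A \<Longrightarrow> a \<in> B \<Longrightarrow> f' (g (\<pi>, a)) = f \<pi> + of_bool (a = h \<pi>)"
  shows "card {\<sigma> \<in> A'. f' \<sigma> = m} =
    card {\<pi> \<in> A. Suc (f \<pi>) = m} + (card B - 1) * card {\<pi> \<in> A. f \<pi> = m}"
proof -
  define P where "P = (\<lambda>\<pi>. (\<pi>, h \<pi>)) ` {\<pi> \<in> A. Suc (f \<pi>) = m}"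
  define Q where "Q = Sigma {\<pi> \<in> A. f \<pi> = m} (\<lambda>\<pi>. B - {h \<pi>})"
  have PQ: "P \<union> Q = {x \<in> A \<times> B. f' (g x) = m}"
    unfolding P_def Q_def using h f' by (auto split: if_splits)
  have "{\<sigma> \<in> A'. f' \<sigma> = m} = g ` {x \<in> A \<times> B. f' (g x) = m}"
    using bij_betw_imp_surj_on[OF bij] by auto
  moreover have "inj_on g {x \<in> A \<times> B. f' (g x) = m}"
    using bij_betw_imp_inj_on[OF bij] by (rule inj_on_subset) auto
  ultimately have "card {\<sigma> \<in> A'. f' \<sigma> = m} = card (P \<union> Q)"
    by (simp add: card_image PQ)
  also have "\<dots> = card P + card Q"
    by (rule card_Un_disjoint) (use fin in \<open>auto simp: P_def Q_def\<close>)
  also have "card P = card {\<pi> \<in> A. Suc (f \<pi>) = m}"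
    unfolding P_def by (rule card_image) (auto intro: inj_onI)
  also have "card Q = (\<Sum>\<pi> \<in> {\<pi> \<in> A. f \<pi> = m}. card B - 1)"
    unfolding Q_def using fin h by (simp add: card_SigmaI)
  finally show ?thesis by simp
qed

text \<open>
  Any family of coset representatives \<open>c a\<close> of the stabiliser of \<open>x\<close> gives such a bijection: the
  image of \<open>x\<close> under \<open>c a \<circ> \<pi>\<close> is \<open>a\<close>, so it determines \<open>c a\<close> and hence \<open>\<pi>\<close>. Transpositions are
  the right choice for cycles, order-preserving shifts for patterns.
\<close>
lemma bij_betw_permutes_insert:
  assumes "x \<notin> S"
    and c: "\<And>a. a \<in> insert x S \<Longrightarrow> c a permutes insert x S"
    and cx: "\<And>a. a \<in> insert x S \<Longrightarrow> c a x = a"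
  shows "bij_betw (\<lambda>(\<pi>, a). c a \<circ> \<pi>)
    ({\<pi>. \<pi> permutes S} \<times> insert x S) {\<sigma>. \<sigma> permutes insert x S}"
proof (rule bij_betw_imageI)
  show "inj_on (\<lambda>(\<pi>, a). c a \<circ> \<pi>) ({\<pi>. \<pi> permutes S} \<times> insert x S)"
  proof (rule inj_onI, clarify)
    fix \<pi> a \<rho> b
    assume p: "\<pi> permutes S" "\<rho> permutes S" and ab: "a \<in> insert x S" "b \<in> insert x S"
      and eq: "c a \<circ> \<pi> = c b \<circ> \<rho>"
    have "\<pi> x = x" "\<rho> x = x" using p \<open>x \<notin> S\<close> by (auto simp: permutes_def)
    with fun_cong[OF eq, of x] have "a = b" using cx ab by simp
    moreover have "\<pi> = \<rho>"
    proof
      fix y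
      have "c a (\<pi> y) = c a (\<rho> y)" using fun_cong[OF eq, of y] \<open>a = b\<close> by simp
      then show "\<pi> y = \<rho> y" using permutes_inj[OF c[OF ab(1)]] by (simp add: inj_eq)
    qed
    ultimately show "\<pi> = \<rho> \<and> a = b" by simp
  qed
  show "(\<lambda>(\<pi>, a). c a \<circ> \<pi>) ` ({\<pi>. \<pi> permutes S} \<times> insert x S) = {\<sigma>. \<sigma> permutes insert x S}"
  proof (intro equalityI subsetI)
    fix \<sigma> assume "\<sigma> \<in> (\<lambda>(\<pi>, a). c a \<circ> \<pi>) ` ({\<pi>. \<pi> permutes S} \<times> insert x S)"
    then show "\<sigma> \<in> {\<sigma>. \<sigma> permutes insert x S}"
      by (auto intro!: permutes_compose c intro: permutes_imp_permutes_insert)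
  next
    fix \<sigma> assume "\<sigma> \<in> {\<sigma>. \<sigma> permutes insert x S}"
    then have s: "\<sigma> permutes insert x S" by simp
    define a where "a = \<sigma> x"
    have a: "a \<in> insert x S" unfolding a_def using permutes_in_image[OF s] by blast
    note ca = c[OF a]
    define \<pi> where "\<pi> = inv (c a) \<circ> \<sigma>"
    have "\<pi> permutes insert x S"
      unfolding \<pi>_def by (rule permutes_compose[OF s permutes_inv[OF ca]])
    moreover have "\<pi> x = x"
      unfolding \<pi>_def using cx[OF a] permutes_inverses(2)[OF ca, of x] by (simp add: a_def)
    ultimately have "\<pi> permutes S"
      by (auto intro: permutes_superset)
    moreover have "\<sigma> = c a \<circ> \<pi>"
      unfolding \<pi>_def by (simp add: fun_eq_iff permutes_inverses[OF ca])
    ultimately show "\<sigma> \<in> (\<lambda>(\<pi>, a). c a \<circ> \<pi>) ` ({\<pi>. \<pi> permutes S} \<times> insert x S)"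
      using a by force
  qed
qed

text \<open>
  The same bijection seen through inverses, which exchanges the roles of positions and letters: now
  \<open>c a\<close> rearranges positions, and a fixed \<open>d\<close> relabels the letters.
\<close>
lemma bij_betw_permutes_insert_inv:
  assumes "x \<notin> S"
    and c: "\<And>a. a \<in> insert x S \<Longrightarrow> c a permutes insert x S"
    and cx: "\<And>a. a \<in> insert x S \<Longrightarrow> c a x = a"
    and d: "d permutes insert x S"
  shows "bij_betw (\<lambda>(\<pi>, a). d \<circ> \<pi> \<circ> inv (c a))
    ({\<pi>. \<pi> permutes S} \<times> insert x S) {\<sigma>. \<sigma> permutes insert x S}"
proof -
  have invS: "bij_betw inv {\<pi>. \<pi> permutes U} {\<pi>. \<pi> permutes U}" for U :: "'a set"
    by (rule bij_betw_byWitness[where f' = inv])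
      (auto simp: permutes_inv permutes_inv_inv)
  have dd: "bij_betw ((\<circ>) d) {\<sigma>. \<sigma> permutes insert x S} {\<sigma>. \<sigma> permutes insert x S}"
  proof (rule bij_betw_byWitness[where f' = "(\<circ>) (inv d)"])
    show "\<forall>\<sigma>\<in>{\<sigma>. \<sigma> permutes insert x S}. inv d \<circ> (d \<circ> \<sigma>) = \<sigma>"
      by (simp add: fun_eq_iff permutes_inverses[OF d])
    show "\<forall>\<sigma>\<in>{\<sigma>. \<sigma> permutes insert x S}. d \<circ> (inv d \<circ> \<sigma>) = \<sigma>"
      by (simp add: fun_eq_iff permutes_inverses[OF d])
  qed (use permutes_compose[OF _ d] permutes_compose[OF _ permutes_inv[OF d]] in blast)+
  have bij: "bij_betw ((\<circ>) d \<circ> (inv \<circ> ((\<lambda>(\<pi>, a). c a \<circ> \<pi>) \<circ> map_prod inv id)))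
    ({\<pi>. \<pi> permutes S} \<times> insert x S) {\<sigma>. \<sigma> permutes insert x S}"
    by (rule bij_betw_trans[OF bij_betw_trans[OF bij_betw_trans[OF
          bij_betw_map_prod[OF invS bij_betw_id] bij_betw_permutes_insert[OF assms(1-3)]] invS] dd])
  have eq: "((\<circ>) d \<circ> (inv \<circ> ((\<lambda>(\<pi>, a). c a \<circ> \<pi>) \<circ> map_prod inv id))) y =
      (\<lambda>(\<pi>, a). d \<circ> \<pi> \<circ> inv (c a)) y"
    if "y \<in> {\<pi>. \<pi> permutes S} \<times> insert x S" for y
  proof -
    obtain \<pi> a where y: "y = (\<pi>, a)" by (cases y)
    then have \<pi>: "\<pi> permutes S" and a: "a \<in> insert x S" using that by simp_all
    have "inv (c a \<circ> inv \<pi>) = inv (inv \<pi>) \<circ> inv (c a)"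
      by (rule o_inv_distrib[OF permutes_bij[OF c[OF a]] permutes_bij[OF permutes_inv[OF \<pi>]]])
    then show ?thesis by (simp add: y permutes_inv_inv[OF \<pi>] o_assoc)
  qed
  from bij show ?thesis by (rule bij_betw_cong[THEN iffD1, rotated]) (rule eq)
qed

section \<open>Cycles\<close>

text \<open>
  Composing with the transposition of a fixed point \<open>x\<close> and \<open>b\<close> replaces the step \<open>y \<mapsto> b\<close> by
  \<open>y \<mapsto> x \<mapsto> b\<close>: it splices \<open>x\<close> into the cycle of \<open>b\<close> and leaves every other cycle alone.
\<close>
lemma orbit_transpose_insert:
  assumes p: "\<pi> permutes S" and S: "finite S" "x \<notin> S" "b \<in> S" "i \<in> S"
  shows "orbit (transpose x b \<circ> \<pi>) i = (if b \<in> orbit \<pi> i then insert x (orbit \<pi> i) else orbit \<pi> i)"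
    (is "orbit ?s i = ?R")
proof -
  have px: "\<pi> x = x" using p S by (auto simp: permutes_def)
  have sx: "?s x = b" using px by simp
  have inS: "j \<in> S" if "j \<in> orbit \<pi> i" for j
    using permutes_orbit_subset[OF p \<open>i \<in> S\<close>] that by blast
  have neq: "\<pi> j \<noteq> x" if "j \<in> S" for j
    using permutes_in_image[OF p, of j] that S by auto
  have "permutation \<pi>" using p S by (auto simp: permutation_permutes)
  \<comment> \<open>One step of \<open>\<pi>\<close> is one step of the new permutation, or two steps passing through \<open>x\<close>.\<close>
  have pj: "\<pi> j \<in> orbit ?s k" if j: "j \<in> orbit ?s k \<or> j = k" and "j \<in> S" for j k
  proof (cases "\<pi> j = b")
    case True
    then have "?s j = x" by simp
    then have "x \<in> orbit ?s k" using j by (metis orbit.base orbit.step)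
    then have "?s x \<in> orbit ?s k" by (rule orbit.step)
    with sx True show ?thesis by simp
  next
    case False
    with neq[OF \<open>j \<in> S\<close>] have "?s j = \<pi> j" by (simp add: transpose_def)
    then show ?thesis using j by (metis orbit.base orbit.step)
  qed
  have sub: "j \<in> orbit ?s i" if "j \<in> orbit \<pi> i" for j
    using that
  proof induction
    case base
    show ?case by (rule pj[of i i]) (use \<open>i \<in> S\<close> in simp_all)
  next
    case (step y)
    show ?case by (rule pj[of y i]) (use step inS in \<open>simp_all del: o_apply\<close>)
  qed
  show ?thesis
  proof (intro equalityI subsetI)
    fix j assume "j \<in> orbit ?s i"
    then show "j \<in> ?R"
    proof induction
      case base
      show ?case using orbit.base[of \<pi> i] neq[OF \<open>i \<in> S\<close>] by (auto simp: transpose_def)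
    next
      case (step y)
      show ?case
      proof (cases "y = x")
        case True
        then have "b \<in> orbit \<pi> i" using step.IH inS S by (auto split: if_splits)
        then show ?thesis using True sx by simp
      next
        case False
        then have y: "y \<in> orbit \<pi> i" using step.IH by (auto split: if_splits)
        from orbit.step[OF this] neq[OF inS[OF this]] show ?thesis
          by (auto simp: transpose_def)
      qed
    qed
  next
    fix j assume j: "j \<in> ?R"
    show "j \<in> orbit ?s i"
    proof (cases "j \<in> orbit \<pi> i")
      case False
      with j have b: "b \<in> orbit \<pi> i" "j = x" by (auto split: if_splits)
      define y where "y = inv \<pi> b"
      have py: "\<pi> y = b" unfolding y_def by (rule permutes_inverses(1)[OF p])
      have "y \<in> orbit \<pi> b"
        using orbit_inv_eq[OF \<open>permutation \<pi>\<close>, of b] orbit.base[of "inv \<pi>" b]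
        by (simp add: y_def)
      then have "y \<in> orbit ?s i" by (intro sub orbit_trans[OF _ b(1)])
      then have "?s y \<in> orbit ?s i" by (rule orbit.step)
      then show ?thesis using py b by simp
    qed (rule sub)
  qed
qed

lemma card_orbits_transpose_insert:
  assumes p: "\<pi> permutes S" and S: "finite S" "x \<notin> S" "b \<in> insert x S"
  shows "card (orbit (transpose x b \<circ> \<pi>) ` insert x S) =
    card (orbit \<pi> ` S) + of_bool (b = x)"
proof (cases "b = x")
  case True
  have "\<pi> x = x" using p S by (auto simp: permutes_def)
  then have "orbit \<pi> x = {x}" by (simp add: orbit_eq_singleton_iff)
  moreover have "{x} \<notin> orbit \<pi> ` S"
    using permutes_orbit_subset[OF p] S by blast
  ultimately show ?thesis using True S by simp
next
  case False
  then have b: "b \<in> S" using S by simp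
  let ?s = "transpose x b \<circ> \<pi>"
  \<comment> \<open>\<open>F\<close> turns old cycles into new ones; removing \<open>x\<close> undoes it, so the numbers agree.\<close>
  define F where "F = (\<lambda>C. if b \<in> C then insert x C else C)"
  have "\<pi> x = x" using p S by (auto simp: permutes_def)
  then have sx: "?s x = b" by simp
  have "?s permutes insert x S"
    by (rule permutes_compose[OF permutes_imp_permutes_insert[OF p] permutes_swap_id]) (use S in auto)
  then have "permutation ?s" using S by (auto simp: permutation_permutes)
  then have "orbit ?s x = orbit ?s b"
    using permutation_orbit_step sx by metis
  then have "orbit ?s ` insert x S = orbit ?s ` S" using b by auto
  also have "\<dots> = F ` (orbit \<pi> ` S)"
    unfolding image_image F_def
    by (rule image_cong[OF refl]) (rule orbit_transpose_insert[OF p S(1,2) b])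
  also have "card \<dots> = card (orbit \<pi> ` S)"
  proof (rule card_image, rule inj_onI)
    fix C D assume CD: "C \<in> orbit \<pi> ` S" "D \<in> orbit \<pi> ` S" "F C = F D"
    then have "x \<notin> C" "x \<notin> D" using permutes_orbit_subset[OF p] S by blast+
    moreover have "F C - {x} = F D - {x}" using CD by simp
    ultimately show "C = D" by (auto simp: F_def split: if_splits)
  qed
  finally show ?thesis using False by simp
qed

lemma stirling_cycles_eq_stirling: "stirling_cycles n j = stirling n j"
proof (induction n arbitrary: j)
  case 0
  have "{\<pi>. \<pi> permutes {1..0::nat} \<and> num_cycles 0 \<pi> = j} = (if j = 0 then {id} else {})"
    by (auto simp: num_cycles_def)
  then show ?case by (cases j) (auto simp: stirling_cycles_def)
next
  case (Suc n)
  have ins: "insert (Suc n) {1..n} = {1..Suc n}" by auto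
  have bij: "bij_betw (\<lambda>(\<pi>, a). transpose (Suc n) a \<circ> \<pi>)
    ({\<pi>. \<pi> permutes {1..n}} \<times> {1..Suc n}) {\<sigma>. \<sigma> permutes {1..Suc n}}"
    by (rule bij_betw_permutes_insert[of "Suc n" "{1..n}", unfolded ins])
      (auto intro: permutes_swap_id)
  have "stirling_cycles (Suc n) j = card {\<sigma> \<in> {\<sigma>. \<sigma> permutes {1..Suc n}}. num_cycles (Suc n) \<sigma> = j}"
    by (simp add: stirling_cycles_def)
  also have "\<dots> = card {\<pi> \<in> {\<pi>. \<pi> permutes {1..n}}. Suc (num_cycles n \<pi>) = j} +
     (card {1..Suc n} - 1) * card {\<pi> \<in> {\<pi>. \<pi> permutes {1..n}}. num_cycles n \<pi> = j}"
  proof (rule card_statistic_insertion[OF _ _ bij, where h = "\<lambda>_. Suc n"])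
    fix \<pi> a assume "\<pi> \<in> {\<pi>. \<pi> permutes {1..n}}" "a \<in> {1..Suc n}"
    then show "num_cycles (Suc n) (case (\<pi>, a) of (\<pi>, a) \<Rightarrow> transpose (Suc n) a \<circ> \<pi>)
      = num_cycles n \<pi> + of_bool (a = Suc n)"
      using card_orbits_transpose_insert[of \<pi> "{1..n}" "Suc n" a, unfolded ins]
      by (simp add: num_cycles_def)
  qed (auto simp: finite_permutations)
  also have "\<dots> = stirling (Suc n) j"
    using Suc.IH by (cases j; cases n) (simp_all add: stirling_cycles_def)
  finally show ?case .
qed

section \<open>Inserting a letter or a position\<close>

text \<open>
  The cycle that sends \<open>n + 1\<close> to \<open>a\<close> and is increasing on \<open>{1..n}\<close>. Applied to the letters of
  a permutation of \<open>{1..n}\<close>, which has \<open>n + 1\<close> as a fixed point, it appends the letter \<open>a\<close>; applied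
  to positions, it opens a gap at position \<open>a\<close>. For \<open>a = 1\<close> it adds one to every letter.
\<close>
definition make_room :: "nat \<Rightarrow> nat \<Rightarrow> nat \<Rightarrow> nat" where
  "make_room n a i = (if i = Suc n then a else if a \<le> i \<and> i \<le> n then Suc i else i)"

lemma make_room_permutes:
  assumes "1 \<le> a" "a \<le> Suc n"
  shows "make_room n a permutes {1..Suc n}"
proof (rule bij_imp_permutes)
  have "inj_on (make_room n a) {1..Suc n}"
    by (auto simp: inj_on_def make_room_def split: if_splits)
  moreover have "make_room n a ` {1..Suc n} \<subseteq> {1..Suc n}"
    using assms by (auto simp: make_room_def)
  ultimately show "bij_betw (make_room n a) {1..Suc n} {1..Suc n}"
    by (simp add: bij_betw_def endo_inj_surj)
qed (use assms in \<open>auto simp: make_room_def\<close>)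

lemma make_room_last [simp]: "make_room n a (Suc n) = a"
  by (simp add: make_room_def)

lemma make_room_less_iff:
  "i \<le> n \<Longrightarrow> j \<le> n \<Longrightarrow> make_room n a i < make_room n a j \<longleftrightarrow> i < j"
  by (auto simp: make_room_def)

lemma atLeastAtMost_Suc_insert: "insert (Suc n) {1..n} = {1..Suc n}"
  by auto

lemma bij_betw_insert_last:
  "bij_betw (\<lambda>(\<pi>, a). make_room n a \<circ> \<pi>)
    ({\<pi>. \<pi> permutes {1..n}} \<times> {1..Suc n}) {\<sigma>. \<sigma> permutes {1..Suc n}}"
  by (rule bij_betw_permutes_insert[of "Suc n" "{1..n}", unfolded atLeastAtMost_Suc_insert])
    (simp_all add: make_room_permutes[simplified])

lemma bij_betw_insert_least:
  "bij_betw (\<lambda>(\<pi>, a). make_room n 1 \<circ> \<pi> \<circ> inv (make_room n a))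
    ({\<pi>. \<pi> permutes {1..n}} \<times> {1..Suc n}) {\<sigma>. \<sigma> permutes {1..Suc n}}"
  by (rule bij_betw_permutes_insert_inv[of "Suc n" "{1..n}", unfolded atLeastAtMost_Suc_insert])
    (simp_all add: make_room_permutes[simplified])

lemma finite_mesh12_occs: "finite (mesh12_occs R n \<pi>)"
  by (rule finite_subset[of _ "{1..n} \<times> {1..n}"]) (auto simp: mesh12_occs_def)

section \<open>The first pattern\<close>

text \<open>
  The four shaded boxes fill the quadrant to the left of \<open>t\<close> and below \<open>\<pi> t\<close>, except the lines
  through the point of \<open>s\<close>, and a permutation has no other point on these lines.
\<close>
lemma mesh12_occs_p1:
  assumes p: "\<pi> permutes {1..n}"
  shows "mesh12_occs p1 n \<pi> = {(s, t). t \<in> {1..n} \<and> s \<in> {1..<t} \<and> \<pi> s < \<pi> t \<and>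
    (\<forall>m\<in>{1..<t}. \<pi> m < \<pi> t \<longrightarrow> m = s)}"
proof -
  have pos: "0 < \<pi> m" if "m \<in> {1..n}" for m
    using permutes_in_image[OF p, of m] that by auto
  have eq: "\<pi> m = \<pi> s \<longleftrightarrow> m = s" for m s
    using permutes_inj[OF p] by (simp add: inj_eq)
  have boxes: "(s, t) \<in> mesh12_occs p1 n \<pi> \<longleftrightarrow> (\<forall>m\<in>{1..n}.
      \<not> (m < s \<and> \<pi> m < \<pi> s) \<and> \<not> (m < s \<and> \<pi> s < \<pi> m \<and> \<pi> m < \<pi> t) \<and>
      \<not> (s < m \<and> m < t \<and> \<pi> m < \<pi> s) \<and> \<not> (s < m \<and> m < t \<and> \<pi> s < \<pi> m \<and> \<pi> m < \<pi> t))"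
    if st: "s \<in> {1..n}" "t \<in> {1..n}" "s < t" "\<pi> s < \<pi> t" for s t
    using st pos by (simp add: mesh12_occs_def p1_def Let_def ball_conj_distrib)
  have "(s, t) \<in> mesh12_occs p1 n \<pi> \<longleftrightarrow> (\<forall>m\<in>{1..<t}. \<pi> m < \<pi> t \<longrightarrow> m = s)"
    if st: "s \<in> {1..n}" "t \<in> {1..n}" "s < t" "\<pi> s < \<pi> t" for s t
  proof
    assume L: "(s, t) \<in> mesh12_occs p1 n \<pi>"
    show "\<forall>m\<in>{1..<t}. \<pi> m < \<pi> t \<longrightarrow> m = s"
    proof (intro ballI impI, rule ccontr)
      fix m assume m: "m \<in> {1..<t}" "\<pi> m < \<pi> t" "m \<noteq> s"
      then have "m < s \<or> s < m" "\<pi> m < \<pi> s \<or> \<pi> s < \<pi> m" using eq[of m s] by auto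
      moreover have "m \<in> {1..n}" "m < t" using m(1) st(2) by auto
      ultimately show False using L[unfolded boxes[OF st]] m(2) by blast
    qed
  next
    assume R: "\<forall>m\<in>{1..<t}. \<pi> m < \<pi> t \<longrightarrow> m = s"
    have "m = s" if "m \<in> {1..n}" "m < s \<or> m < t" "\<pi> m < \<pi> s \<or> \<pi> m < \<pi> t" for m
    proof -
      have "m \<in> {1..<t}" "\<pi> m < \<pi> t" using that st by auto
      then show ?thesis using R by blast
    qed
    moreover have "\<not> s < s" by simp
    ultimately show "(s, t) \<in> mesh12_occs p1 n \<pi>"
      unfolding boxes[OF st] by blast
  qed
  moreover have "s \<in> {1..n} \<and> t \<in> {1..n} \<and> s < t \<and> \<pi> s < \<pi> t"
    if "(s, t) \<in> mesh12_occs p1 n \<pi>" for s t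
    using that by (simp add: mesh12_occs_def)
  moreover have "s \<in> {1..<t} \<longleftrightarrow> s \<in> {1..n} \<and> s < t" if "t \<in> {1..n}" for s t
    using that by auto
  ultimately show ?thesis by blast
qed

text \<open>
  If \<open>a = 2\<close>, the only letter below the appended one is \<open>1\<close>, which stands at \<open>inv \<pi> 1\<close> and is not
  moved up.
\<close>
lemma mesh12_occs_p1_insert_last:
  assumes p: "\<pi> permutes {1..n}" and n: "n \<ge> 1" and a: "a \<in> {1..Suc n}"
  shows "mesh12_occs p1 (Suc n) (make_room n a \<circ> \<pi>) =
    mesh12_occs p1 n \<pi> \<union> (if a = 2 then {(inv \<pi> 1, Suc n)} else {})"
proof -
  let ?s = "make_room n a \<circ> \<pi>"
  have a': "1 \<le> a" "a \<le> Suc n" using a by simp_all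
  have s: "?s permutes {1..Suc n}"
    by (rule permutes_compose[OF _ make_room_permutes[OF a']])
      (rule permutes_imp_permutes_insert[OF p, of "Suc n", unfolded atLeastAtMost_Suc_insert])
  have last: "?s (Suc n) = a" using p by (simp add: permutes_def)
  have im: "\<pi> i \<in> {1..n}" if "i \<in> {1..n}" for i
    using permutes_in_image[OF p] that by blast
  have less: "?s i < ?s j \<longleftrightarrow> \<pi> i < \<pi> j" if "i \<in> {1..n}" "j \<in> {1..n}" for i j
    using im[OF that(1)] im[OF that(2)] by (simp add: make_room_less_iff)
  have below: "?s i < a \<longleftrightarrow> \<pi> i < a" if "i \<in> {1..n}" for i
    using im[OF that] by (auto simp: make_room_def)
  define s0 where "s0 = inv \<pi> 1"
  have ps0: "\<pi> s0 = 1" unfolding s0_def by (rule permutes_inverses(1)[OF p])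
  have s0: "s0 \<in> {1..n}"
    using permutes_in_image[OF permutes_inv[OF p], of 1] n by (simp add: s0_def)
  have uniq: "\<pi> i = 1 \<longleftrightarrow> i = s0" for i
    using permutes_inj[OF p] ps0 by (metis inj_eq)
  \<comment> \<open>If \<open>a \<ge> 3\<close>, the letters \<open>1\<close> and \<open>2\<close> both lie below \<open>a\<close>; if \<open>a = 1\<close>, none does.\<close>
  have new: "(i \<in> {1..n} \<and> \<pi> i < a \<and> (\<forall>m\<in>{1..n}. \<pi> m < a \<longrightarrow> m = i)) \<longleftrightarrow> a = 2 \<and> i = s0" for i
  proof
    assume L: "i \<in> {1..n} \<and> \<pi> i < a \<and> (\<forall>m\<in>{1..n}. \<pi> m < a \<longrightarrow> m = i)"
    then have "a > 1" using im[of i] by auto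
    then have "i = s0" using L s0 ps0 by metis
    have "a = 2"
    proof (rule ccontr)
      assume "a \<noteq> 2"
      with \<open>a > 1\<close> have a3: "a \<ge> 3" by simp
      define m where "m = inv \<pi> 2"
      have "\<pi> m = 2" unfolding m_def by (rule permutes_inverses(1)[OF p])
      moreover have "m \<in> {1..n}"
        using permutes_in_image[OF permutes_inv[OF p], of 2] a3 a by (simp add: m_def)
      ultimately have "m = i" using L a3 by simp
      then show False using \<open>i = s0\<close> \<open>\<pi> m = 2\<close> ps0 by simp
    qed
    then show "a = 2 \<and> i = s0" using \<open>i = s0\<close> by simp
  next
    assume R: "a = 2 \<and> i = s0"
    have "m = s0" if "m \<in> {1..n}" "\<pi> m < 2" for m
    proof -
      have "\<pi> m = 1" using im[OF that(1)] that(2) by simp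
      then show ?thesis by (simp only: uniq)
    qed
    moreover have "\<pi> s0 < 2" using ps0 by linarith
    ultimately show "i \<in> {1..n} \<and> \<pi> i < a \<and> (\<forall>m\<in>{1..n}. \<pi> m < a \<longrightarrow> m = i)"
      using s0 unfolding conjunct1[OF R] conjunct2[OF R] by blast
  qed
  have "(i, j) \<in> mesh12_occs p1 (Suc n) ?s \<longleftrightarrow>
      (i, j) \<in> mesh12_occs p1 n \<pi> \<union> (if a = 2 then {(s0, Suc n)} else {})" for i j
  proof (cases "j = Suc n")
    case True
    have "(i, Suc n) \<in> mesh12_occs p1 (Suc n) ?s \<longleftrightarrow>
      i \<in> {1..n} \<and> ?s i < a \<and> (\<forall>m\<in>{1..n}. ?s m < a \<longrightarrow> m = i)"
      unfolding mesh12_occs_p1[OF s] mem_Collect_eq case_prod_conv last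
        atLeastLessThanSuc_atLeastAtMost by simp
    also have "\<dots> \<longleftrightarrow> i \<in> {1..n} \<and> \<pi> i < a \<and> (\<forall>m\<in>{1..n}. \<pi> m < a \<longrightarrow> m = i)"
      by (intro conj_cong ball_cong imp_cong refl below)
    also have "\<dots> \<longleftrightarrow> a = 2 \<and> i = s0" by (rule new)
    finally show ?thesis using True by (simp add: mesh12_occs_def del: o_apply)
  next
    case False
    have less': "?s i < ?s j \<longleftrightarrow> \<pi> i < \<pi> j" if "j \<in> {1..n}" "i \<in> {1..<j}" for i j
      by (rule less) (use that in auto)
    have "(i, j) \<in> mesh12_occs p1 (Suc n) ?s \<longleftrightarrow> j \<in> {1..n} \<and> i \<in> {1..<j} \<and>
      ?s i < ?s j \<and> (\<forall>m\<in>{1..<j}. ?s m < ?s j \<longrightarrow> m = i)"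
      unfolding mesh12_occs_p1[OF s] mem_Collect_eq case_prod_conv
      using False by (intro conj_cong refl) auto
    also have "\<dots> \<longleftrightarrow> j \<in> {1..n} \<and> i \<in> {1..<j} \<and>
      \<pi> i < \<pi> j \<and> (\<forall>m\<in>{1..<j}. \<pi> m < \<pi> j \<longrightarrow> m = i)"
      by (intro conj_cong ball_cong imp_cong refl less')
    finally show ?thesis
      unfolding mesh12_occs_p1[OF p] using False by simp
  qed
  then have "mesh12_occs p1 (Suc n) ?s =
      mesh12_occs p1 n \<pi> \<union> (if a = 2 then {(s0, Suc n)} else {})"
    by (intro set_eqI) (simp only: split_paired_all)
  then show ?thesis unfolding s0_def .
qed

section \<open>The second pattern\<close>

text \<open>
  The boxes of the middle row forbid any letter strictly between \<open>\<pi> s\<close> and \<open>\<pi> t\<close>, which forces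
  consecutive values; the remaining box forbids larger letters between the two positions.
\<close>
lemma mesh12_occs_p2:
  assumes p: "\<pi> permutes {1..n}"
  shows "mesh12_occs p2 n \<pi> = {(s, t). s \<in> {1..n} \<and> t \<in> {1..n} \<and> s < t \<and> \<pi> t = Suc (\<pi> s) \<and>
    (\<forall>m. s < m \<and> m < t \<longrightarrow> \<pi> m < \<pi> t)}"
proof -
  have im: "\<pi> m \<in> {1..n}" if "m \<in> {1..n}" for m
    using permutes_in_image[OF p] that by blast
  have eq: "\<pi> m = \<pi> s \<longleftrightarrow> m = s" for m s
    using permutes_inj[OF p] by (simp add: inj_eq)
  have bound: "0 < \<pi> m" "\<pi> m \<le> n" if "m \<in> {1..n}" for m
    using im[OF that] by auto
  have boxes: "(s, t) \<in> mesh12_occs p2 n \<pi> \<longleftrightarrow> \<pi> s < \<pi> t \<and> (\<forall>m\<in>{1..n}.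
      \<not> (m < s \<and> \<pi> s < \<pi> m \<and> \<pi> m < \<pi> t) \<and> \<not> (s < m \<and> m < t \<and> \<pi> s < \<pi> m \<and> \<pi> m < \<pi> t) \<and>
      \<not> (s < m \<and> m < t \<and> \<pi> t < \<pi> m) \<and> \<not> (t < m \<and> \<pi> s < \<pi> m \<and> \<pi> m < \<pi> t))"
    if st: "s \<in> {1..n}" "t \<in> {1..n}" "s < t" for s t
    using st bound by (simp add: mesh12_occs_def p2_def Let_def less_Suc_eq_le ball_conj_distrib) blast
  have "(s, t) \<in> mesh12_occs p2 n \<pi> \<longleftrightarrow> \<pi> t = Suc (\<pi> s) \<and> (\<forall>m. s < m \<and> m < t \<longrightarrow> \<pi> m < \<pi> t)"
    if st: "s \<in> {1..n}" "t \<in> {1..n}" "s < t" for s t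
  proof
    assume L: "(s, t) \<in> mesh12_occs p2 n \<pi>"
    then have lt: "\<pi> s < \<pi> t" by (simp add: mesh12_occs_def)
    have no: "\<not> (\<pi> s < \<pi> m \<and> \<pi> m < \<pi> t)" if "m \<in> {1..n}" for m
    proof -
      have "m < s \<or> m = s \<or> (s < m \<and> m < t) \<or> m = t \<or> m > t" by auto
      moreover have "\<not> \<pi> m < \<pi> m" by simp
      ultimately show ?thesis using L[unfolded boxes[OF st]] that by blast
    qed
    have "\<pi> t = Suc (\<pi> s)"
    proof (rule ccontr)
      assume "\<pi> t \<noteq> Suc (\<pi> s)"
      define m where "m = inv \<pi> (Suc (\<pi> s))"
      have m: "\<pi> m = Suc (\<pi> s)" unfolding m_def by (rule permutes_inverses(1)[OF p])
      have "m \<in> {1..n}"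
        using permutes_in_image[OF permutes_inv[OF p], of "Suc (\<pi> s)"] lt im[OF st(2)]
        by (simp add: m_def)
      with no[OF this] m lt \<open>\<pi> t \<noteq> Suc (\<pi> s)\<close> show False by simp
    qed
    moreover have "\<pi> m < \<pi> t" if "s < m" "m < t" for m
    proof -
      have "m \<in> {1..n}" using st that by auto
      then have "\<not> \<pi> t < \<pi> m" using L[unfolded boxes[OF st]] that by blast
      moreover have "\<pi> m \<noteq> \<pi> t" using eq that by simp
      ultimately show ?thesis by simp
    qed
    ultimately show "\<pi> t = Suc (\<pi> s) \<and> (\<forall>m. s < m \<and> m < t \<longrightarrow> \<pi> m < \<pi> t)" by blast
  next
    assume R: "\<pi> t = Suc (\<pi> s) \<and> (\<forall>m. s < m \<and> m < t \<longrightarrow> \<pi> m < \<pi> t)"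
    then have "\<not> (\<pi> s < \<pi> m \<and> \<pi> m < \<pi> t)" for m by simp
    moreover have "\<not> (s < m \<and> m < t \<and> \<pi> t < \<pi> m)" for m using R less_asym by blast
    moreover have "\<pi> s < \<pi> t" using R by simp
    ultimately show "(s, t) \<in> mesh12_occs p2 n \<pi>"
      unfolding boxes[OF st] by blast
  qed
  moreover have "s \<in> {1..n} \<and> t \<in> {1..n} \<and> s < t" if "(s, t) \<in> mesh12_occs p2 n \<pi>" for s t
    using that by (simp add: mesh12_occs_def)
  ultimately show ?thesis by blast
qed

text \<open>
  The condition \<open>a = inv \<pi> 1\<close> says that the new letter \<open>1\<close> is placed where the old \<open>1\<close>
  stood. The old \<open>1\<close> becomes the letter \<open>2\<close> and is pushed to position \<open>a + 1\<close>.
\<close>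
lemma mesh12_occs_p2_insert_least:
  assumes p: "\<pi> permutes {1..n}" and n: "n \<ge> 1" and a: "a \<in> {1..Suc n}"
  defines "c \<equiv> make_room n a"
  shows "mesh12_occs p2 (Suc n) (make_room n 1 \<circ> \<pi> \<circ> inv c) =
    map_prod c c ` mesh12_occs p2 n \<pi> \<union> (if a = inv \<pi> 1 then {(a, Suc a)} else {})"
proof -
  let ?s = "make_room n 1 \<circ> \<pi> \<circ> inv c"
  have a': "1 \<le> a" "a \<le> Suc n" using a by simp_all
  have c: "c permutes {1..Suc n}" unfolding c_def by (rule make_room_permutes[OF a'])
  have p': "\<pi> permutes {1..Suc n}"
    by (rule permutes_imp_permutes_insert[OF p, of "Suc n", unfolded atLeastAtMost_Suc_insert])
  have s: "?s permutes {1..Suc n}"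
    by (intro permutes_compose permutes_inv[OF c] p' make_room_permutes) simp_all
  have im: "\<pi> i \<in> {1..n}" if "i \<in> {1..n}" for i
    using permutes_in_image[OF p] that by blast
  have sc: "?s (c i) = Suc (\<pi> i)" if "i \<in> {1..n}" for i
    using im[OF that] permutes_inverses(2)[OF c] by (simp add: make_room_def)
  have sa: "?s a = 1"
  proof -
    have "inv c a = Suc n" using permutes_inverses(2)[OF c, of "Suc n"] by (simp add: c_def)
    moreover have "\<pi> (Suc n) = Suc n" using p by (simp add: permutes_def)
    ultimately show ?thesis by simp
  qed
  have cmono: "c i < c j \<longleftrightarrow> i < j" if "i \<in> {1..n}" "j \<in> {1..n}" for i j
    using that by (simp add: c_def make_room_less_iff)
  have cin: "c i \<in> {1..Suc n}" "c i \<noteq> a" if "i \<in> {1..n}" for i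
    using that a by (auto simp: c_def make_room_def)
  have csurj: "\<exists>i\<in>{1..n}. j = c i" if "j \<in> {1..Suc n}" "j \<noteq> a" for j
  proof -
    have j: "c (inv c j) = j" by (simp add: permutes_inverses[OF c])
    moreover have "inv c j \<in> {1..Suc n}" using permutes_in_image[OF permutes_inv[OF c]] that by blast
    moreover have "inv c j \<noteq> Suc n"
    proof
      assume "inv c j = Suc n"
      then have "c (Suc n) = j" using j by simp
      then show False using that by (simp add: c_def)
    qed
    ultimately show ?thesis by (intro bexI[of _ "inv c j"]) simp_all
  qed
  have old: "(c i, c j) \<in> mesh12_occs p2 (Suc n) ?s \<longleftrightarrow> (i, j) \<in> mesh12_occs p2 n \<pi>"
    if ij: "i \<in> {1..n}" "j \<in> {1..n}" for i j
  proof -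
    have "(\<forall>m. c i < m \<and> m < c j \<longrightarrow> ?s m < ?s (c j)) \<longleftrightarrow> (\<forall>m. i < m \<and> m < j \<longrightarrow> \<pi> m < \<pi> j)" (is "?L \<longleftrightarrow> ?R")
    proof
      assume L: ?L
      show ?R
      proof (intro allI impI)
        fix m assume m: "i < m \<and> m < j"
        then have "m \<in> {1..n}" using ij by auto
        then have "?s (c m) < ?s (c j)" using L m cmono ij by blast
        then show "\<pi> m < \<pi> j" using sc[OF \<open>m \<in> _\<close>] sc[OF ij(2)] by simp
      qed
    next
      assume R: ?R
      show ?L
      proof (intro allI impI)
        fix m assume m: "c i < m \<and> m < c j"
        show "?s m < ?s (c j)"
        proof (cases "m = a")
          case True
          then show ?thesis using sa sc[OF ij(2)] im[OF ij(2)] by simp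
        next
          case False
          moreover have "m \<in> {1..Suc n}" using m cin(1)[OF ij(2)] by auto
          ultimately obtain k where k: "k \<in> {1..n}" "m = c k" using csurj by blast
          then have "\<pi> k < \<pi> j" using R m cmono ij by blast
          then show ?thesis using sc[OF k(1)] sc[OF ij(2)] k(2) by simp
        qed
      qed
    qed
    then show ?thesis
      unfolding mesh12_occs_p2[OF s] mesh12_occs_p2[OF p]
      using ij cmono[OF ij] cin(1)[OF ij(1)] cin(1)[OF ij(2)] sc[OF ij(1)] sc[OF ij(2)]
      by (simp del: o_apply)
  qed
  \<comment> \<open>The least letter cannot end an occurrence.\<close>
  have to_a: "(i, a) \<notin> mesh12_occs p2 (Suc n) ?s" for i
  proof
    assume "(i, a) \<in> mesh12_occs p2 (Suc n) ?s"
    then have "?s a = Suc (?s i)" "i \<in> {1..Suc n}" by (simp_all only: mesh12_occs_p2[OF s] mem_Collect_eq case_prod_conv)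
    then show False using sa permutes_in_image[OF s, of i] by (simp del: o_apply)
  qed
  define s0 where "s0 = inv \<pi> 1"
  have ps0: "\<pi> s0 = 1" unfolding s0_def by (rule permutes_inverses(1)[OF p])
  have s0: "s0 \<in> {1..n}"
    using permutes_in_image[OF permutes_inv[OF p], of 1] n by (simp add: s0_def)
  have uniq: "\<pi> i = 1 \<longleftrightarrow> i = s0" for i
    using permutes_inj[OF p] ps0 by (metis inj_eq)
  have from_a: "(a, c j) \<in> mesh12_occs p2 (Suc n) ?s \<longleftrightarrow> a = s0 \<and> c j = Suc a" if j: "j \<in> {1..n}" for j
  proof
    assume L: "(a, c j) \<in> mesh12_occs p2 (Suc n) ?s"
    then have L': "a < c j" "?s (c j) = Suc (?s a)" "\<forall>m. a < m \<and> m < c j \<longrightarrow> ?s m < ?s (c j)"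
      unfolding mesh12_occs_p2[OF s] mem_Collect_eq case_prod_conv by - (elim conjE, assumption)+
    have "\<pi> j = 1" using L'(2) unfolding sc[OF j] sa by simp
    then have js: "j = s0" using uniq by simp
    have "c j = Suc a"
    proof (rule ccontr)
      assume "c j \<noteq> Suc a"
      \<comment> \<open>A letter between \<open>1\<close> and \<open>2\<close> in position would have to be smaller than \<open>2\<close>.\<close>
      then have 1: "a < Suc a" "Suc a < c j" using L'(1) by auto
      then have "Suc a \<in> {1..Suc n}" using cin(1)[OF j] by auto
      then obtain k where k: "k \<in> {1..n}" "Suc a = c k" using csurj[of "Suc a"] by auto
      have "?s (c k) < ?s (c j)" using L'(3) 1 by (simp only: k(2))
      then have "\<pi> k < 1" using sc[OF k(1)] sc[OF j] \<open>\<pi> j = 1\<close> by (simp del: o_apply)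
      then show False using im[OF k(1)] by simp
    qed
    moreover have "j = a" using \<open>c j = Suc a\<close> j by (auto simp: c_def make_room_def split: if_splits)
    ultimately show "a = s0 \<and> c j = Suc a" using js by simp
  next
    assume R: "a = s0 \<and> c j = Suc a"
    then have "j = a" using j by (auto simp: c_def make_room_def split: if_splits)
    then have "\<pi> j = 1" using R ps0 by simp
    then show "(a, c j) \<in> mesh12_occs p2 (Suc n) ?s"
      unfolding mesh12_occs_p2[OF s] mem_Collect_eq case_prod_conv sa sc[OF j]
      using R a cin(1)[OF j] by (auto simp del: o_apply)
  qed
  have c_s0: "c s0 = Suc a" if "a = s0" using that s0 by (simp add: c_def make_room_def)
  have sub: "i \<in> {1..Suc n} \<and> j \<in> {1..Suc n}" if "(i, j) \<in> mesh12_occs p2 (Suc n) ?s" for i j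
    using that by (simp add: mesh12_occs_def del: o_apply)
  have sub': "i \<in> {1..n} \<and> j \<in> {1..n}" if "(i, j) \<in> mesh12_occs p2 n \<pi>" for i j
    using that by (simp add: mesh12_occs_def)
  have "mesh12_occs p2 (Suc n) ?s =
    map_prod c c ` mesh12_occs p2 n \<pi> \<union> (if a = s0 then {(a, Suc a)} else {})"
  proof (intro equalityI subsetI)
    fix x assume x: "x \<in> mesh12_occs p2 (Suc n) ?s"
    obtain i j where ij: "x = (i, j)" by (cases x)
    have "j \<noteq> a" using to_a x ij by blast
    then obtain j' where j': "j' \<in> {1..n}" "j = c j'" using csurj sub x ij by blast
    show "x \<in> map_prod c c ` mesh12_occs p2 n \<pi> \<union> (if a = s0 then {(a, Suc a)} else {})"
    proof (cases "i = a")
      case True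
      then show ?thesis using from_a[OF j'(1)] x ij j' by simp
    next
      case False
      then obtain i' where "i' \<in> {1..n}" "i = c i'" using csurj sub x ij by blast
      then have "(i', j') \<in> mesh12_occs p2 n \<pi>" "x = map_prod c c (i', j')"
        using old[of i' j'] j' x ij by simp_all
      then show ?thesis by blast
    qed
  next
    fix x assume "x \<in> map_prod c c ` mesh12_occs p2 n \<pi> \<union> (if a = s0 then {(a, Suc a)} else {})"
    then consider i j where "(i, j) \<in> mesh12_occs p2 n \<pi>" "x = (c i, c j)" | "a = s0" "x = (a, Suc a)"
      by (auto split: if_splits)
    then show "x \<in> mesh12_occs p2 (Suc n) ?s"
    proof cases
      case 1
      then show ?thesis using old sub' by blast
    next
      case 2
      then show ?thesis using from_a[OF s0] c_s0 by simp
    qed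
  qed
  then show ?thesis by (simp only: s0_def)
qed

section \<open>The distribution\<close>

lemma mesh12_count_Suc:
  assumes p: "p = p1 \<or> p = p2" and n: "n \<ge> 1"
  shows "mesh12_count p (Suc n) k =
    card {\<pi>. \<pi> permutes {1..n} \<and> Suc (card (mesh12_occs p n \<pi>)) = k} + n * mesh12_count p n k"
  using p
proof
  assume p: "p = p1"
  have "card {\<sigma> \<in> {\<sigma>. \<sigma> permutes {1..Suc n}}. card (mesh12_occs p1 (Suc n) \<sigma>) = k} =
    card {\<pi> \<in> {\<pi>. \<pi> permutes {1..n}}. Suc (card (mesh12_occs p1 n \<pi>)) = k} +
    (card {1..Suc n} - 1) * card {\<pi> \<in> {\<pi>. \<pi> permutes {1..n}}. card (mesh12_occs p1 n \<pi>) = k}"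
  proof (rule card_statistic_insertion[OF _ _ bij_betw_insert_last, where h = "\<lambda>_. 2"])
    fix \<pi> a assume "\<pi> \<in> {\<pi>. \<pi> permutes {1..n}}" and a: "a \<in> {1..Suc n}"
    then have "\<pi> permutes {1..n}" by simp
    moreover have "(inv \<pi> 1, Suc n) \<notin> mesh12_occs p1 n \<pi>" by (simp add: mesh12_occs_def)
    ultimately show "card (mesh12_occs p1 (Suc n) (case (\<pi>, a) of (\<pi>, a) \<Rightarrow> make_room n a \<circ> \<pi>))
      = card (mesh12_occs p1 n \<pi>) + of_bool (a = 2)"
      using n a by (simp add: mesh12_occs_p1_insert_last finite_mesh12_occs)
  qed (use n in \<open>auto simp: finite_permutations\<close>)
  then show ?thesis by (simp add: p mesh12_count_def)
next
  assume p: "p = p2"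
  have "card {\<sigma> \<in> {\<sigma>. \<sigma> permutes {1..Suc n}}. card (mesh12_occs p2 (Suc n) \<sigma>) = k} =
    card {\<pi> \<in> {\<pi>. \<pi> permutes {1..n}}. Suc (card (mesh12_occs p2 n \<pi>)) = k} +
    (card {1..Suc n} - 1) * card {\<pi> \<in> {\<pi>. \<pi> permutes {1..n}}. card (mesh12_occs p2 n \<pi>) = k}"
  proof (rule card_statistic_insertion[OF _ _ bij_betw_insert_least, where h = "\<lambda>\<pi>. inv \<pi> 1"])
    fix \<pi> a assume "\<pi> \<in> {\<pi>. \<pi> permutes {1..n}}" and a: "a \<in> {1..Suc n}"
    then have \<pi>: "\<pi> permutes {1..n}" by simp
    have a': "1 \<le> a" "a \<le> Suc n" using a by simp_all
    define c where "c = make_room n a"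
    have c: "inj c" unfolding c_def by (rule permutes_inj[OF make_room_permutes[OF a']])
    have ne: "(a, Suc a) \<notin> map_prod c c ` mesh12_occs p2 n \<pi>"
    proof
      assume "(a, Suc a) \<in> map_prod c c ` mesh12_occs p2 n \<pi>"
      then obtain i where "i \<in> {1..n}" "c i = a" by (auto simp: mesh12_occs_def)
      then show False by (auto simp: c_def make_room_def split: if_splits)
    qed
    have "card (map_prod c c ` mesh12_occs p2 n \<pi>) = card (mesh12_occs p2 n \<pi>)"
      by (rule card_image) (rule inj_on_subset[OF map_prod_inj_on[OF c c]], simp)
    moreover have "mesh12_occs p2 (Suc n) (make_room n 1 \<circ> \<pi> \<circ> inv c) =
        map_prod c c ` mesh12_occs p2 n \<pi> \<union> (if a = inv \<pi> 1 then {(a, Suc a)} else {})"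
      unfolding c_def by (rule mesh12_occs_p2_insert_least[OF \<pi> n a])
    moreover have "card (A \<union> (if P then {x} else {})) = card A + of_bool P"
      if "finite A" "x \<notin> A" for A and P and x :: "nat \<times> nat"
      using that by simp
    note this[OF finite_imageI[OF finite_mesh12_occs] ne]
    ultimately show "card (mesh12_occs p2 (Suc n)
        (case (\<pi>, a) of (\<pi>, a) \<Rightarrow> make_room n 1 \<circ> \<pi> \<circ> inv (make_room n a)))
      = card (mesh12_occs p2 n \<pi>) + of_bool (a = inv \<pi> 1)"
      unfolding prod.case c_def[symmetric] by (simp only:)
  next
    fix \<pi> assume "\<pi> \<in> {\<pi>. \<pi> permutes {1..n}}"
    then have "inv \<pi> permutes {1..n}" by (simp add: permutes_inv)
    from permutes_in_image[OF this, of 1] n show "inv \<pi> 1 \<in> {1..Suc n}" by simp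
  qed (use n in \<open>auto simp: finite_permutations\<close>)
  then show ?thesis by (simp add: p mesh12_count_def)
qed

lemma mesh12_count_eq_stirling:
  assumes p: "p = p1 \<or> p = p2" and "n \<ge> 1"
  shows "mesh12_count p n k = stirling n (Suc k)"
  using \<open>n \<ge> 1\<close>
proof (induction n arbitrary: k rule: dec_induct)
  case base
  have "mesh12_occs p 1 \<pi> = {}" for \<pi> by (auto simp: mesh12_occs_def)
  then have "{\<pi>. \<pi> permutes {1..1} \<and> card (mesh12_occs p 1 \<pi>) = k} = (if k = 0 then {id} else {})"
    by (auto simp: permutes_sing)
  then show ?case by (cases k) (auto simp: mesh12_count_def)
next
  case (step n)
  then show ?case
    using mesh12_count_Suc[OF p, of n k] step.IH
    by (cases k) (simp_all add: mesh12_count_def)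
qed

text \<open>
  The polynomial identity is the recurrence summed against powers of \<open>x\<close>: appending an element
  multiplies the generating polynomial by \<open>x + (n + 1)\<close>.
\<close>
lemma stirling_generating_polynomial:
  "(\<Sum>k\<le>n. monom (int (stirling (Suc n) (Suc k))) k) = (\<Prod>i=1..n. [:int i, 1:])"
proof (induction n)
  case (Suc n)
  let ?s = "\<lambda>k. monom (int (stirling (Suc n) (Suc k))) k"
  have "(\<Sum>k\<le>Suc n. monom (int (stirling (Suc (Suc n)) (Suc k))) k) =
     (\<Sum>k\<le>Suc n. [:int (Suc n):] * ?s k) + (\<Sum>k\<le>Suc n. monom (int (stirling (Suc n) k)) k)"
    unfolding sum.distrib[symmetric] stirling.simps(4)[of "Suc n"]
    by (simp add: smult_monom add_monom del: stirling.simps of_nat_Suc mult_Suc)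
  also have "(\<Sum>k\<le>Suc n. [:int (Suc n):] * ?s k) = [:int (Suc n):] * (\<Sum>k\<le>n. ?s k)"
    unfolding sum_distrib_left[symmetric] by (simp del: stirling.simps(4) mult_pCons_left)
  also have "(\<Sum>k\<le>Suc n. monom (int (stirling (Suc n) k)) k) = [:0, 1:] * (\<Sum>k\<le>n. ?s k)"
    unfolding sum.atMost_Suc_shift sum_distrib_left
    by (simp add: monom_Suc del: stirling.simps(4))
  also have "[:int (Suc n):] * (\<Sum>k\<le>n. ?s k) + [:0, 1:] * (\<Sum>k\<le>n. ?s k) =
     (\<Sum>k\<le>n. ?s k) * [:int (Suc n), 1:]"
    unfolding distrib_right[symmetric] by (simp add: mult.commute del: of_nat_Suc mult_pCons_left mult_pCons_right)
  finally show ?case unfolding Suc.IH by (simp del: of_nat_Suc stirling.simps)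
qed simp

theorem theorem4p1:
  fixes p :: "(nat \<times> nat) set" and T :: "nat \<Rightarrow> nat \<Rightarrow> nat"
  assumes "p = p1 \<or> p = p2"
  defines "T \<equiv> mesh12_count p"
  shows "(\<forall>n\<ge>2. \<forall>k\<ge>1. T n k = T (n - 1) (k - 1) + (n - 1) * T (n - 1) k)
    \<and> (\<forall>n\<ge>1. T n 0 = fact (n - 1))
    \<and> T 0 0 = 1
    \<and> (\<forall>n\<ge>1. \<forall>k. T n k = stirling_cycles n (k + 1))
    \<and> (\<forall>n\<ge>1. (\<Sum>k=0..n-1. monom (int (T n k)) k) = (\<Prod>i=1..n-1. [:int i, 1:]))"
proof (intro conjI allI impI)
  have T: "T n k = stirling n (Suc k)" if "n \<ge> 1" for n k
    using mesh12_count_eq_stirling[OF assms(1) that] by (simp add: T_def)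
  show "T n k = T (n - 1) (k - 1) + (n - 1) * T (n - 1) k" if nk: "n \<ge> 2" "k \<ge> 1" for n k
  proof -
    obtain m l where [simp]: "n = Suc m" "k = Suc l" using nk by (cases n; cases k) auto
    show ?thesis using nk by (simp add: T)
  qed
  show "T n 0 = fact (n - 1)" if "n \<ge> 1" for n
    using T[OF that, of 0] that stirling_Suc_n_1[of "n - 1"] by simp
  have "{\<pi>. \<pi> permutes {1..0::nat} \<and> card (mesh12_occs p 0 \<pi>) = 0} = {id}"
    by (auto simp: mesh12_occs_def)
  then show "T 0 0 = 1" by (simp add: T_def mesh12_count_def)
  show "T n k = stirling_cycles n (k + 1)" if "n \<ge> 1" for n k
    using T[OF that] by (simp add: stirling_cycles_eq_stirling)
  show "(\<Sum>k=0..n-1. monom (int (T n k)) k) = (\<Prod>i=1..n-1. [:int i, 1:])" if "n \<ge> 1" for n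
    using stirling_generating_polynomial[of "n - 1"] that by (simp add: T atLeast0AtMost)
qed

end
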